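(* Let $\mathcal{B}\in\mathcal{A}^{q+k}$ and $\mathcal{R}\in\mathcal{A}^q$. Fix any $w_0\in\mathcal{R}$. The following are equivalent: (i) $\mathcal{R}$ is $\mathcal{A}^k$-implementable, i.e. there exists $\mathcal{C}\in\mathcal{A}^k$ such that $\mathcal{B}\Vert\mathcal{C}=\mathcal{R}$; (ii) $\mathcal{R}\subseteq\pi_w(\mathcal{B})$ and for some $c_0\in(\mathbb{R}^k)^{\mathbb{Z}}$ such that $(w_0,c_0)\in\mathcal{B}$, we have $\mathcal{B}\Vert c_0\subseteq\mathcal{R}$; (iii) $w_0+\operatorname{dif}(\mathcal{B})\Vert 0\subseteq\mathcal{R}\subseteq\pi_w(\mathcal{B})$.
   Context: $(\mathbb{R}^q)^{\mathbb{Z}}$ is the set of all maps $\mathbb{Z}\to\mathbb{R}^q$, and $(\sigma^\tau w)(t)=w(t+\tau)$ for $\tau\in\mathbb{Z}$. For $t_0\le t_1$, $w_{[t_0,t_1]}$ is the stacked vector of $w(t_0),\dots,w(t_1)$, and $\mathcal{B}_{[t_0,t_1]}=\{w_{[t_0,t_1]}:w\in\mathcal{B}\}$. A behavior is a nonempty set $\mathcal{B}\subseteq(\mathbb{R}^q)^{\mathbb{Z}}$. It is time-invariant if $w\in\mathcal{B}$ implies $\sigma^t w\in\mathcal{B}$ for all $t\in\mathbb{Z}$. It is complete if there is an integer $L\ge 0$ such that every $w\in(\mathbb{R}^q)^{\mathbb{Z}}$ with $w_{[t,t+L]}\in\mathcal{B}_{[t,t+L]}$ for all $t\in\mathbb{Z}$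 belongs to $\mathcal{B}$. $\mathcal{A}^q$ is the set of nonempty, time-invariant, complete behaviors in $(\mathbb{R}^q)^{\mathbb{Z}}$ that are affine: $\alpha w_1+(1-\alpha)w_2\in\mathcal{B}$ for all $w_1,w_2\in\mathcal{B}$, $\alpha\in\mathbb{R}$. $\operatorname{dif}(\mathcal{B}):=\{v_1-v_2:v_1,v_2\in\mathcal{B}\}$. Let $q,k$ be nonnegative integers. Trajectories of $\mathcal{B}\in\mathcal{A}^{q+k}$ are written as pairs $(w,c)$ with $w\in(\mathbb{R}^q)^{\mathbb{Z}}$ (to-be-controlled variables) and $c\in(\mathbb{R}^k)^{\mathbb{Z}}$ (control variables); $\pi_w$ is the projection $(w,c)\mapsto w$. For $\mathcal{C}\subseteq(\mathbb{R}^k)^{\mathbb{Z}}$, $\mathcal{B}\Join\mathcal{C}:=\{(w,c)\in\mathcal{B}:c\in\mathcal{C}\}$ and $\mathcal{B}\Vert\mathcal{C}:=\pi_w(\mathcal{B}\Join\mathcal{C})$. For a single trajectory $c_0$, $\mathcal{B}\Vert c_0:=\mathcal{B}\Vert\{c_0\}$; in particular $\operatorname{dif}(\mathcal{B})\Vert 0=\{w:(w,0)\in\operatorname{dif}(\mathcal{B})\}$. The sum $w_0+X$ is $\{w_0+x:x\in X\}$. Convention for $q=0$ (full interconnection): $\mathcal{B}\Join\mathcal{C}=\mathcal{B}\Vert\mathcal{C}=\mathcal{B}\cap\mathcal{C}$ and $\pi_w(\mathcal{B})=\mathcal{B}$; references are then behaviors $\mathcal{R}\in\mathcal{A}^k$,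 and "$(w_0,c_0)\in\mathcal{B}$" is read as $w_0=c_0\in\mathcal{B}$. *)

theory Defs
  imports "Jordan_Normal_Form.Matrix"
begin

type_synonym signal = "int \<Rightarrow> real vec"

definition signals :: "nat \<Rightarrow> signal set" where
  "signals q = {w. \<forall>t. w t \<in> carrier_vec q}"

definition shift :: "int \<Rightarrow> signal \<Rightarrow> signal" where
  "shift \<tau> w = (\<lambda>t. w (t + \<tau>))"

definition window :: "int \<Rightarrow> int \<Rightarrow> signal \<Rightarrow> real vec" where
  "window t0 t1 w = foldr (\<lambda>t v. w t @\<^sub>v v) [t0..t1] (0\<^sub>v 0)"

definition behavior :: "nat \<Rightarrow> signal set \<Rightarrow> bool" where
  "behavior q B \<longleftrightarrow> B \<noteq> {} \<and> B \<subseteq> signals q"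

definition time_invariant :: "signal set \<Rightarrow> bool" where
  "time_invariant B \<longleftrightarrow> (\<forall>w\<in>B. \<forall>t. shift t w \<in> B)"

definition complete_behavior :: "nat \<Rightarrow> signal set \<Rightarrow> bool" where
  "complete_behavior q B \<longleftrightarrow>
     (\<exists>L\<ge>0. \<forall>w\<in>signals q. (\<forall>t. window t (t + L) w \<in> window t (t + L) ` B) \<longrightarrow> w \<in> B)"

definition affine_behavior :: "signal set \<Rightarrow> bool" where
  "affine_behavior B \<longleftrightarrow>
     (\<forall>w1\<in>B. \<forall>w2\<in>B. \<forall>\<alpha>::real. (\<lambda>t. \<alpha> \<cdot>\<^sub>v w1 t + (1 - \<alpha>) \<cdot>\<^sub>v w2 t) \<in> B)"

definition affine_behaviors :: "nat \<Rightarrow> signal set set" where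
  "affine_behaviors q =
     {B. behavior q B \<and> time_invariant B \<and> complete_behavior q B \<and> affine_behavior B}"

definition dif :: "signal set \<Rightarrow> signal set" where
  "dif B = {\<lambda>t. v1 t - v2 t | v1 v2. v1 \<in> B \<and> v2 \<in> B}"

definition translate :: "signal \<Rightarrow> signal set \<Rightarrow> signal set" where
  "translate w0 X = {\<lambda>t. w0 t + x t | x. x \<in> X}"

definition zero_signal :: "nat \<Rightarrow> signal" where
  "zero_signal k = (\<lambda>t. 0\<^sub>v k)"

text \<open>
  A signal in \<open>\<real>\<^sup>q\<^sup>+\<^sup>k\<close> is read as a pair \<open>(w, c)\<close>, where \<open>w\<close> consists of the first \<open>q\<close>
  components and \<open>c\<close> of the last \<open>k\<close>. For \<open>q = 0\<close> the convention of full interconnection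
  applies: the to-be-controlled variables are the control variables themselves, so that
  references live in \<open>\<real>\<^sup>k\<close>, the projection to \<open>w\<close> is the identity, and
  \<open>(w, c) \<in> B\<close> means \<open>w = c \<in> B\<close>.
\<close>

definition ref_dim :: "nat \<Rightarrow> nat \<Rightarrow> nat" where
  "ref_dim q k = (if q = 0 then k else q)"

definition proj_w :: "nat \<Rightarrow> signal \<Rightarrow> signal" where
  "proj_w q x = (if q = 0 then x else (\<lambda>t. vec_first (x t) q))"

definition proj_c :: "nat \<Rightarrow> signal \<Rightarrow> signal" where
  "proj_c k x = (\<lambda>t. vec_last (x t) k)"

definition pair_mem :: "nat \<Rightarrow> signal \<Rightarrow> signal \<Rightarrow> signal set \<Rightarrow> bool" where
  "pair_mem q w c B \<longleftrightarrow> (if q = 0 then w = c \<and> w \<in> B else (\<lambda>t. w t @\<^sub>v c t) \<in> B)"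

definition join :: "nat \<Rightarrow> signal set \<Rightarrow> signal set \<Rightarrow> signal set" where
  "join k B C = {x \<in> B. proj_c k x \<in> C}"

definition controlled :: "nat \<Rightarrow> nat \<Rightarrow> signal set \<Rightarrow> signal set \<Rightarrow> signal set" where
  "controlled q k B C = proj_w q ` join k B C"

definition implementable :: "nat \<Rightarrow> nat \<Rightarrow> signal set \<Rightarrow> signal set \<Rightarrow> bool" where
  "implementable q k B R \<longleftrightarrow> (\<exists>C\<in>affine_behaviors k. controlled q k B C = R)"

lemma proj_c_id:
  assumes "B \<subseteq> signals k" "x \<in> B"
  shows "proj_c k x = x"
proof
  fix t
  have "dim_vec (x t) = k" using assms by (auto simp: signals_def)
  then show "proj_c k x t = x t" by (auto simp: proj_c_def vec_last_def)
qed

lemma controlled_full: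
  assumes "B \<subseteq> signals k"
  shows "join k B C = B \<inter> C" and "controlled 0 k B C = B \<inter> C"
proof -
  show "join k B C = B \<inter> C" using proj_c_id[OF assms] by (auto simp: join_def)
  then show "controlled 0 k B C = B \<inter> C" by (simp add: controlled_def proj_w_def)
qed

lemma pair_mem_iff_proj:
  assumes "B \<subseteq> signals (q + k)" "w \<in> signals (ref_dim q k)" "c \<in> signals k"
  shows "pair_mem q w c B \<longleftrightarrow> (\<exists>x\<in>B. proj_w q x = w \<and> proj_c k x = c)"
proof (cases "q = 0")
  case True
  have "proj_c k x = x" if "x \<in> B" for x
    using proj_c_id[of B k x] that assms(1) True by simp
  with True show ?thesis by (auto simp: pair_mem_def proj_w_def)
next
  case False
  have "vec_first (w t @\<^sub>v c t) q = w t" "vec_last (w t @\<^sub>v c t) k = c t" for t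
  proof -
    have "dim_vec (w t) = q" "dim_vec (c t) = k"
      using assms(2,3) False by (auto simp: signals_def ref_dim_def)
    then show "vec_first (w t @\<^sub>v c t) q = w t" "vec_last (w t @\<^sub>v c t) k = c t"
      by (auto simp: vec_first_def vec_last_def)
  qed
  moreover have "(\<lambda>t. vec_first (x t) q @\<^sub>v vec_last (x t) k) = x" if "x \<in> B" for x
    using that assms(1) by (auto simp: signals_def subset_iff fun_eq_iff)
  ultimately show ?thesis
    using False by (fastforce simp: pair_mem_def proj_w_def proj_c_def)
qed

end

theory Submission imports Defs "HOL-Library.Countable" begin

text \<open>
  For \<open>x \<in> B\<close> with \<open>\<pi>\<^sub>w x = w0\<close>, the trajectories of \<open>B\<close> with the
  same control trajectory as \<open>x\<close> are \<open>x\<close> plus the elements of \<open>dif B\<close> with zero control. Hence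
  the behavior that remains when the control of \<open>x\<close> is fixed is \<open>w0\<close> plus the \<^emph>\<open>hidden\<close> behavior
  \<open>dif B \<parallel> 0\<close> (\<open>translate_hidden_eq\<close>). This set does not depend on \<open>x\<close>, which identifies (ii)
  with (iii), and a controller that accepts \<open>x\<close> cannot remove any part of it, so that (i)
  implies (iii).

  For (iii) \<open>\<Longrightarrow>\<close> (i), take as controller the set \<open>C\<close> of all control trajectories that occur in
  \<open>B\<close> together with some element of \<open>R\<close>. Two trajectories of \<open>B\<close> with the same control
  differ by a hidden one, and \<open>R\<close> is affine and contains the hidden behavior translated to one of
  its points, hence to all of them. As \<open>R \<subseteq> \<pi>\<^sub>w B\<close>, it follows that \<open>C\<close> implements \<open>R\<close>. The only real difficulty is that
  \<open>C\<close>, a projection, is again complete: an elimination theorem. Instead of kernel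
  representations over Laurent polynomials, the proof passes through a topological condition:
  \<open>finitely_determined\<close>, that is, closedness in the product of the discrete topologies. It
  has three parts.

  \<^item> Complete behaviors are closed (\<open>complete_imp_finitely_determined\<close>).
  \<^item> Projections of closed affine behaviors are closed (\<open>elimination\<close>). The values that must
    be found for the eliminated variables solve infinitely many affine conditions of which all
    finite parts are solvable; they are chosen one real coordinate at a time, because a
    decreasing sequence of nonempty affine subsets of the line has a common point
    (\<open>linear_compactness\<close>).
  \<^item> Closed, affine, time-invariant behaviors are complete
    (\<open>finitely_determined_imp_complete\<close>). The directions in which a trajectory that has been
    zero for \<open>n\<close> steps can leave zero form a decreasing sequence of subspaces of \<open>\<real>\<^sup>k\<close>, which
    becomes constant (\<open>finite_memory\<close>). Beyond that point two overlapping windows of the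
    behavior can be glued, so that windows of one fixed length determine all longer ones.
\<close>

section \<open>Signals and windows\<close>

lemma signals_dim: "X \<subseteq> signals m \<Longrightarrow> x \<in> X \<Longrightarrow> dim_vec (x t) = m"
  by (auto simp: signals_def)

lemma signals_carrier: "X \<subseteq> signals m \<Longrightarrow> x \<in> X \<Longrightarrow> x t \<in> carrier_vec m"
  by (auto simp: signals_def)

lemma window_eq_iff:
  assumes "w \<in> signals q" "v \<in> signals q"
  shows "window t0 t1 w = window t0 t1 v \<longleftrightarrow> (\<forall>t\<in>{t0..t1}. w t = v t)"
proof -
  have "foldr (\<lambda>t u. w t @\<^sub>v u) ts (0\<^sub>v 0) = foldr (\<lambda>t u. v t @\<^sub>v u) ts (0\<^sub>v 0)
      \<longleftrightarrow> (\<forall>t\<in>set ts. w t = v t)" for ts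
  proof (induction ts)
    case (Cons t ts)
    have "w t \<in> carrier_vec q" "v t \<in> carrier_vec q"
      using assms by (auto simp: signals_def)
    then show ?case using Cons by (simp add: append_vec_eq)
  qed simp
  then show ?thesis by (simp add: window_def)
qed

section \<open>Completeness implies closedness\<close>

text \<open>
  Closedness in the product topology, with each \<open>\<real>\<^sup>q\<close> discrete: unlike completeness, no bound on
  the length of the windows is prescribed. This is what makes the condition stable under
  projection of affine behaviors.
\<close>
definition finitely_determined :: "nat \<Rightarrow> signal set \<Rightarrow> bool" where
  "finitely_determined q B \<longleftrightarrow>
     (\<forall>w\<in>signals q. (\<forall>T. finite T \<longrightarrow> (\<exists>b\<in>B. \<forall>t\<in>T. b t = w t)) \<longrightarrow> w \<in> B)"

lemma finitely_determinedD:
  assumes "finitely_determined q B" "w \<in> signals q"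
    and "\<And>T. finite T \<Longrightarrow> \<exists>b\<in>B. \<forall>t\<in>T. b t = w t"
  shows "w \<in> B"
  using assms unfolding finitely_determined_def by blast

lemma complete_imp_finitely_determined:
  assumes "complete_behavior q B" "B \<subseteq> signals q"
  shows "finitely_determined q B"
  unfolding finitely_determined_def
proof (intro ballI impI)
  fix w
  assume w: "w \<in> signals q" and appr: "\<forall>T. finite T \<longrightarrow> (\<exists>b\<in>B. \<forall>t\<in>T. b t = w t)"
  obtain L where L: "\<And>v. v \<in> signals q \<Longrightarrow>
      (\<forall>t. window t (t + L) v \<in> window t (t + L) ` B) \<Longrightarrow> v \<in> B"
    using assms(1) unfolding complete_behavior_def by blast
  have "window t (t + L) w \<in> window t (t + L) ` B" for t
  proof -
    obtain b where b: "b \<in> B" "\<forall>s\<in>{t..t + L}. b s = w s"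
      using appr finite_atLeastAtMost_int by blast
    then have "window t (t + L) b = window t (t + L) w"
      using window_eq_iff[of b q w] w assms(2) by blast
    then show ?thesis using b(1) by (metis image_eqI)
  qed
  then show "w \<in> B" using L w by blast
qed

section \<open>Differences of affine behaviors\<close>

text \<open>
  The parallelogram completion \<open>x + y - z\<close> is twice the midpoint of \<open>x\<close> and \<open>y\<close>, minus \<open>z\<close>.
\<close>
lemma affine_add_diff:
  assumes "affine_behavior B" "B \<subseteq> signals q" "x \<in> B" "y \<in> B" "z \<in> B"
  shows "(\<lambda>t. x t + (y t - z t)) \<in> B"
proof -
  define m where "m = (\<lambda>t. (1/2) \<cdot>\<^sub>v x t + (1 - 1/2) \<cdot>\<^sub>v y t)"
  have "m \<in> B"
    using assms unfolding affine_behavior_def m_def by blast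
  then have "(\<lambda>t. 2 \<cdot>\<^sub>v m t + (1 - 2) \<cdot>\<^sub>v z t) \<in> B"
    using assms unfolding affine_behavior_def by blast
  moreover have "(\<lambda>t. 2 \<cdot>\<^sub>v m t + (1 - 2) \<cdot>\<^sub>v z t) = (\<lambda>t. x t + (y t - z t))"
    using signals_dim[OF assms(2)] assms(3-5)
    by (intro ext eq_vecI) (auto simp: m_def algebra_simps)
  ultimately show ?thesis by simp
qed

lemma difI: "a \<in> B \<Longrightarrow> b \<in> B \<Longrightarrow> (\<lambda>t. a t - b t) \<in> dif B"
  by (auto simp: dif_def)

lemma difE:
  assumes "d \<in> dif B"
  obtains a b where "a \<in> B" "b \<in> B" "d = (\<lambda>t. a t - b t)"
  using assms by (auto simp: dif_def)

lemma dif_signals: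
  assumes "B \<subseteq> signals q"
  shows "dif B \<subseteq> signals q"
  using signals_carrier[OF assms] by (auto simp: signals_def elim!: difE)

lemma dif_add:
  assumes "affine_behavior B" "B \<subseteq> signals q" "d \<in> dif B" "e \<in> dif B"
  shows "(\<lambda>t. d t + e t) \<in> dif B"
proof -
  obtain a b where ab: "a \<in> B" "b \<in> B" "d = (\<lambda>t. a t - b t)"
    using assms(3) by (auto simp: dif_def)
  obtain a' b' where ab': "a' \<in> B" "b' \<in> B" "e = (\<lambda>t. a' t - b' t)"
    using assms(4) by (auto simp: dif_def)
  have "(\<lambda>t. d t + e t) = (\<lambda>t. (a t + (a' t - b' t)) - b t)"
    using signals_dim[OF assms(2)] ab ab' by (intro ext eq_vecI) auto
  then show ?thesis
    using affine_add_diff[OF assms(1,2) ab(1) ab'(1,2)] difI[OF _ ab(2)] by simp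
qed

lemma dif_smult:
  assumes "affine_behavior B" "B \<subseteq> signals q" "d \<in> dif B"
  shows "(\<lambda>t. r \<cdot>\<^sub>v d t) \<in> dif B"
proof -
  obtain a b where ab: "a \<in> B" "b \<in> B" "d = (\<lambda>t. a t - b t)"
    using assms(3) by (auto simp: dif_def)
  have "(\<lambda>t. r \<cdot>\<^sub>v d t) = (\<lambda>t. (r \<cdot>\<^sub>v a t + (1 - r) \<cdot>\<^sub>v b t) - b t)"
    using signals_dim[OF assms(2)] ab by (intro ext eq_vecI) (auto simp: algebra_simps)
  moreover have "(\<lambda>t. r \<cdot>\<^sub>v a t + (1 - r) \<cdot>\<^sub>v b t) \<in> B"
    using assms(1) ab unfolding affine_behavior_def by blast
  ultimately show ?thesis using difI[OF _ ab(2)] by simp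
qed

lemma dif_shift:
  assumes "time_invariant B" "d \<in> dif B"
  shows "shift \<tau> d \<in> dif B"
proof -
  obtain a b where ab: "a \<in> B" "b \<in> B" "d = (\<lambda>t. a t - b t)"
    using assms(2) by (auto simp: dif_def)
  then have "shift \<tau> d = (\<lambda>t. shift \<tau> a t - shift \<tau> b t)" by (simp add: shift_def)
  then show ?thesis using assms(1) ab unfolding time_invariant_def by (simp add: difI)
qed

section \<open>Closed affine time-invariant behaviors are complete\<close>

text \<open>
  The values at time \<open>0\<close> of the elements of \<open>D\<close> that vanish at the preceding \<open>n\<close> times form a
  subspace of \<open>\<real>\<^sup>k\<close> that shrinks as \<open>n\<close> grows, hence is eventually constant. To stay with
  single real numbers, the subspace is recorded by the positions \<open>i\<close> of the leading nonzero
  entries of its vectors (\<open>P n i\<close>): for each \<open>i < k\<close> this is a decreasing sequence of truth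
  values. Equality of leading positions yields equality of the subspaces by elimination of
  the entries one after the other.
\<close>
lemma finite_memory:
  assumes sig: "D \<subseteq> signals k"
    and add: "\<And>d e. d \<in> D \<Longrightarrow> e \<in> D \<Longrightarrow> (\<lambda>t. d t + e t) \<in> D"
    and smult: "\<And>r d. d \<in> D \<Longrightarrow> (\<lambda>t. r \<cdot>\<^sub>v d t) \<in> D"
  obtains N where "\<And>n d. N \<le> n \<Longrightarrow> d \<in> D \<Longrightarrow> \<forall>t\<in>{- int n..<0}. d t = 0\<^sub>v k \<Longrightarrow>
      \<exists>e\<in>D. (\<forall>t\<in>{- int (Suc n)..<0}. e t = 0\<^sub>v k) \<and> e 0 = d 0"
proof -
  define P where "P n i \<longleftrightarrow> (\<exists>d\<in>D. (\<forall>t\<in>{- int n..<0}. d t = 0\<^sub>v k) \<and>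
      (\<forall>j<i. d 0 $ j = 0) \<and> d 0 $ i \<noteq> 0)" for n i
  have anti: "P m i" if "P n i" "m \<le> n" for m n i
    proof -
    obtain d where d: "d \<in> D" "\<forall>t\<in>{- int n..<0}. d t = 0\<^sub>v k" "\<forall>j<i. d 0 $ j = 0" "d 0 $ i \<noteq> 0"
      using \<open>P n i\<close> unfolding P_def by blast
    moreover have "\<forall>t\<in>{- int m..<0}. d t = 0\<^sub>v k" using d(2) \<open>m \<le> n\<close> by auto
    ultimately show ?thesis unfolding P_def by blast
  qed
  have "\<exists>M. \<forall>n\<ge>M. P n i \<longrightarrow> P (Suc n) i" for i
    using anti by blast
  then obtain M where M: "\<And>i n. M i \<le> n \<Longrightarrow> P n i \<Longrightarrow> P (Suc n) i" by metis
  show thesis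
  proof
    fix n d
    assume n: "(\<Sum>i<k. M i) \<le> n" and d: "d \<in> D" "\<forall>t\<in>{- int n..<0}. d t = 0\<^sub>v k"
    \<comment> \<open>Gaussian elimination: correct the entries at time \<open>0\<close> from left to right.\<close>
    have "\<exists>e\<in>D. (\<forall>t\<in>{- int (Suc n)..<0}. e t = 0\<^sub>v k) \<and> (\<forall>j<i. e 0 $ j = d 0 $ j)"
      if "i \<le> k" for i
      using that
    proof (induction i)
      case 0
      have "(\<lambda>t. 0 \<cdot>\<^sub>v d t) \<in> D" "\<And>t. 0 \<cdot>\<^sub>v d t = 0\<^sub>v k"
        using smult d(1) signals_dim[OF sig] by auto
      then show ?case by (intro bexI[of _ "\<lambda>t. 0 \<cdot>\<^sub>v d t"]) auto
    next
      case (Suc i)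
      then obtain e where e: "e \<in> D" "\<forall>t\<in>{- int (Suc n)..<0}. e t = 0\<^sub>v k"
          "\<forall>j<i. e 0 $ j = d 0 $ j"
        by auto
      define g where "g = (\<lambda>t. d t + (-1) \<cdot>\<^sub>v e t)"
      have g: "g \<in> D" unfolding g_def using add smult d(1) e(1) by blast
      note dims = signals_dim[OF sig d(1)] signals_dim[OF sig e(1)]
      show ?case
      proof (cases "g 0 $ i = 0")
        case True
        then have "e 0 $ i = d 0 $ i" using Suc.prems dims by (auto simp: g_def)
        then show ?thesis using e by (auto simp: less_Suc_eq intro!: bexI[of _ e])
      next
        case False
        have "\<forall>t\<in>{- int n..<0}. g t = 0\<^sub>v k" using d(2) e(2) by (auto simp: g_def)
        moreover have "\<forall>j<i. g 0 $ j = 0" using e(3) Suc.prems dims by (auto simp: g_def)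
        ultimately have "P n i" using False g unfolding P_def by blast
        moreover have "M i \<le> n"
          using member_le_sum[of i "{..<k}" M] Suc.prems n by auto
        ultimately have "P (Suc n) i" using M by blast
        then obtain h where h: "h \<in> D" "\<forall>t\<in>{- int (Suc n)..<0}. h t = 0\<^sub>v k"
            "\<forall>j<i. h 0 $ j = 0" "h 0 $ i \<noteq> 0"
          unfolding P_def by blast
        define r where "r = g 0 $ i / h 0 $ i"
        define e' where "e' = (\<lambda>t. e t + r \<cdot>\<^sub>v h t)"
        have "e' \<in> D" unfolding e'_def using add smult e(1) h(1) by blast
        moreover have "\<forall>t\<in>{- int (Suc n)..<0}. e' t = 0\<^sub>v k"
          using e(2) h(2) by (auto simp: e'_def)
        moreover have "\<forall>j<Suc i. e' 0 $ j = d 0 $ j"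
          using e(3) h(3,4) Suc.prems dims signals_dim[OF sig h(1)]
          by (auto simp: e'_def r_def g_def less_Suc_eq)
        ultimately show ?thesis by blast
      qed
    qed
    from this[of k] obtain e where "e \<in> D" "\<forall>t\<in>{- int (Suc n)..<0}. e t = 0\<^sub>v k"
        "\<forall>j<k. e 0 $ j = d 0 $ j"
      by auto
    moreover from this have "e 0 = d 0"
      using signals_dim[OF sig] d(1) by (intro eq_vecI) auto
    ultimately show "\<exists>e\<in>D. (\<forall>t\<in>{- int (Suc n)..<0}. e t = 0\<^sub>v k) \<and> e 0 = d 0"
      by blast
  qed
qed

text \<open>
  Let \<open>N\<close> be the memory bound for \<open>dif C\<close>. If \<open>c1\<close> and \<open>c2\<close> in \<open>C\<close> follow \<open>w\<close> on two windows
  shifted by one step, then \<open>c2 - c1\<close> vanishes on their overlap. When the overlap has at least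
  \<open>N\<close> points, some element of \<open>dif C\<close> vanishes on the whole first window and makes the same
  last step; adding it to \<open>c1\<close> follows \<open>w\<close> on the union. Hence windows of all lengths are
  matched, and closedness applies.
\<close>
lemma finitely_determined_imp_complete:
  assumes sig: "C \<subseteq> signals k" and aff: "affine_behavior C" and ti: "time_invariant C"
    and fd: "finitely_determined k C"
  shows "complete_behavior k C"
proof -
  obtain N where N: "\<And>n d. N \<le> n \<Longrightarrow> d \<in> dif C \<Longrightarrow> \<forall>t\<in>{- int n..<0}. d t = 0\<^sub>v k \<Longrightarrow>
      \<exists>e\<in>dif C. (\<forall>t\<in>{- int (Suc n)..<0}. e t = 0\<^sub>v k) \<and> e 0 = d 0"
    using finite_memory[OF dif_signals[OF sig] dif_add[OF aff sig] dif_smult[OF aff sig]]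
    by metis
  have "w \<in> C" if w: "w \<in> signals k"
    and win: "\<And>t. window t (t + int N) w \<in> window t (t + int N) ` C" for w
  proof -
    have long: "\<exists>c\<in>C. \<forall>s\<in>{t..t + int n}. c s = w s" if "N \<le> n" for n t
      using that
    proof (induction n arbitrary: t rule: dec_induct)
      case base
      obtain c where c: "c \<in> C" "window t (t + int N) c = window t (t + int N) w"
        using win[of t] by (metis imageE)
      then show ?case using window_eq_iff[of c k w] w sig by blast
    next
      case (step n)
      obtain c1 where c1: "c1 \<in> C" "\<forall>s\<in>{t..t + int n}. c1 s = w s"
        using step.IH by blast
      obtain c2 where c2: "c2 \<in> C" "\<forall>s\<in>{t + 1..t + 1 + int n}. c2 s = w s"
        using step.IH by blast
      note dims = signals_carrier[OF sig c1(1)] signals_carrier[OF sig c2(1)]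
      define \<tau> where "\<tau> = t + int (Suc n)"
      define d where "d = (\<lambda>s. c2 s - c1 s)"
      have d: "d \<in> dif C" using c1(1) c2(1) by (auto simp: dif_def d_def)
      have "d s = 0\<^sub>v k" if "s \<in> {t + 1..t + int n}" for s
        using c1(2) c2(2) dims[of s] that by (auto simp: d_def)
      then have "\<forall>s\<in>{- int n..<0}. shift \<tau> d s = 0\<^sub>v k"
        by (auto simp: shift_def \<tau>_def)
      from N[OF step.hyps(1) dif_shift[OF ti d] this] obtain e where
        e: "e \<in> dif C" "\<forall>s\<in>{- int (Suc n)..<0}. e s = 0\<^sub>v k" "e 0 = shift \<tau> d 0"
        by blast
      have e': "shift (-\<tau>) e \<in> dif C" by (rule dif_shift[OF ti e(1)])
      then obtain a b where ab: "a \<in> C" "b \<in> C" "shift (-\<tau>) e = (\<lambda>s. a s - b s)"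
        by (auto simp: dif_def)
      define c where "c = (\<lambda>s. c1 s + shift (-\<tau>) e s)"
      have "c \<in> C" using affine_add_diff[OF aff sig c1(1) ab(1,2)] ab(3) by (simp add: c_def)
      moreover have "c s = w s" if s: "s \<in> {t..t + int (Suc n)}" for s
      proof (cases "s = \<tau>")
        case True
        have "c s = c1 s + (c2 s - c1 s)"
          using e(3) True by (simp add: c_def shift_def d_def)
        also have "\<dots> = c2 s"
          using dims[of s] by (intro eq_vecI) auto
        also have "\<dots> = w s" using c2(2) True by (auto simp: \<tau>_def)
        finally show ?thesis .
      next
        case False
        then have "shift (-\<tau>) e s = 0\<^sub>v k"
          using e(2) s by (auto simp: shift_def \<tau>_def)
        moreover have "c1 s = w s" using c1(2) s False by (auto simp: \<tau>_def)
        ultimately show ?thesis using dims(1)[of s] by (simp add: c_def)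
      qed
      ultimately show ?case by blast
    qed
    show ?thesis
    proof (rule finitely_determinedD[OF fd w])
      fix T :: "int set"
      assume T: "finite T"
      obtain u where u: "\<And>s. s \<in> T \<Longrightarrow> \<bar>s\<bar> \<le> u"
        using bdd_above_finite[OF finite_imageI[OF T, of abs]] unfolding bdd_above_def by blast
      have "T \<subseteq> {- \<bar>u\<bar>..- \<bar>u\<bar> + int (N + nat (2 * \<bar>u\<bar>))}"
      proof
        fix s
        assume "s \<in> T"
        from u[OF this] show "s \<in> {- \<bar>u\<bar>..- \<bar>u\<bar> + int (N + nat (2 * \<bar>u\<bar>))}" by auto
      qed
      then show "\<exists>c\<in>C. \<forall>s\<in>T. c s = w s"
        using long[OF le_add1, of "- \<bar>u\<bar>" "nat (2 * \<bar>u\<bar>)"] by blast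
    qed
  qed
  then show ?thesis unfolding complete_behavior_def
    by (intro exI[of _ "int N"]) auto
qed

section \<open>Projections of closed affine behaviors are closed\<close>

text \<open>
  Coordinates are fixed in the order of an enumeration \<open>e\<close>, with the invariant that every \<open>A n\<close>
  still has an element with the values chosen so far. The values that remain possible for
  the next coordinate form a decreasing sequence of nonempty affine subsets of \<open>\<real>\<close>, each a
  point or the whole line; if a point occurs, all of them contain it.
\<close>
lemma linear_compactness:
  fixes A :: "nat \<Rightarrow> ('i::countable \<Rightarrow> real) set"
  assumes ne: "\<And>n. A n \<noteq> {}" and dec: "\<And>m n. m \<le> n \<Longrightarrow> A n \<subseteq> A m"
    and aff: "\<And>n a b r. a \<in> A n \<Longrightarrow> b \<in> A n \<Longrightarrow> (\<lambda>i. r * a i + (1 - r) * b i) \<in> A n"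
  obtains x where "\<And>n J. finite J \<Longrightarrow> \<exists>a\<in>A n. \<forall>i\<in>J. a i = x i"
proof -
  define e :: "nat \<Rightarrow> 'i" where "e = from_nat"
  define P where "P f m r \<longleftrightarrow> (\<forall>n. \<exists>a\<in>A n. (\<forall>j<m. a (e j) = f j) \<and> a (e m) = r)"
    for f :: "nat \<Rightarrow> real" and m r
  have "\<exists>f. \<forall>m. P f m (f m)"
  proof (rule dependent_wellorder_choice)
    show "P f m r = P g m r" if "\<And>j. j < m \<Longrightarrow> f j = g j" for r f g m
      using that unfolding P_def by auto
  next
    fix m f
    assume IH: "\<And>j. j < m \<Longrightarrow> P f j (f j)"
    define E where "E n = {a \<in> A n. \<forall>j<m. a (e j) = f j}" for n
    have E_ne: "\<exists>a. a \<in> E n" for n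
    proof (cases m)
      case 0
      then show ?thesis using ne[of n] by (auto simp: E_def)
    next
      case (Suc l)
      then have "P f l (f l)" using IH by simp
      then obtain a where "a \<in> A n" "\<forall>j<l. a (e j) = f j" "a (e l) = f l"
        unfolding P_def by blast
      then show ?thesis using Suc by (auto simp: E_def less_Suc_eq)
    qed
    have E_dec: "E n \<subseteq> E n'" if "n' \<le> n" for n n'
      using dec[OF that] by (auto simp: E_def)
    have "\<exists>r. \<forall>n. \<exists>a\<in>E n. a (e m) = r"
    proof (cases "\<exists>n p. \<forall>a\<in>E n. a (e m) = p")
      case True
      then obtain n0 p where p: "\<And>a. a \<in> E n0 \<Longrightarrow> a (e m) = p" by blast
      have "\<exists>a\<in>E n. a (e m) = p" for n
        using E_ne[of "max n n0"] E_dec[of n "max n n0"] E_dec[of n0 "max n n0"] p by auto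
      then show ?thesis by blast
    next
      case False
      \<comment> \<open>No set is a single point, so each is the whole line and contains \<open>0\<close>.\<close>
      have "\<exists>a\<in>E n. a (e m) = 0" for n
      proof -
        obtain b where b: "b \<in> E n" using E_ne by blast
        then obtain a where a: "a \<in> E n" "a (e m) \<noteq> b (e m)" using False by blast
        \<comment> \<open>the root of the affine function \<open>r * a + (1 - r) * b\<close> in coordinate \<open>e m\<close>\<close>
        define r where "r = b (e m) / (b (e m) - a (e m))"
        have "(\<lambda>i. r * a i + (1 - r) * b i) \<in> E n"
          using a(1) b aff[of a n b r] by (auto simp: E_def algebra_simps)
        moreover have "r * a (e m) + (1 - r) * b (e m) = 0"
          using a(2) by (simp add: r_def field_simps)
        ultimately show ?thesis by (intro bexI[of _ "\<lambda>i. r * a i + (1 - r) * b i"])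
      qed
      then show ?thesis by blast
    qed
    then show "\<exists>r. P f m r" unfolding P_def E_def by (simp add: Bex_def conj_assoc)
  qed
  then obtain f where f: "\<And>m. P f m (f m)" by blast
  show thesis
  proof
    fix n and J :: "'i set"
    assume J: "finite J"
    obtain m where m: "\<And>i. i \<in> J \<Longrightarrow> to_nat i \<le> m"
      using bdd_above_finite[OF finite_imageI[OF J, of to_nat]] unfolding bdd_above_def by blast
    obtain a where "a \<in> A n" "\<forall>j<m. a (e j) = f j" "a (e m) = f m"
      using f[of m] unfolding P_def by blast
    moreover have "a i = f (to_nat i)" if "i \<in> J" for i
      using m[OF that] calculation(2,3) by (cases "to_nat i = m") (auto simp: e_def dest: spec[of _ "to_nat i"])
    ultimately show "\<exists>a\<in>A n. \<forall>i\<in>J. a i = f (to_nat i)" by blast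
  qed
qed

lemma proj_c_nth:
  assumes "X \<subseteq> signals (q + k)" "x \<in> X" "i < k"
  shows "proj_c k x t $ i = x t $ (q + i)"
  using signals_dim[OF assms(1,2)] assms(3) by (simp add: proj_c_def vec_last_def vec_first_def)

lemma proj_c_dim: "dim_vec (proj_c k x t) = k"
  by (simp add: proj_c_def vec_last_def)

lemma proj_w_dim:
  assumes "X \<subseteq> signals (q + k)" "x \<in> X"
  shows "dim_vec (proj_w q x t) = ref_dim q k"
  using signals_dim[OF assms] by (auto simp: proj_w_def ref_dim_def)

text \<open>
  Let \<open>c\<close> be approximated by projections of elements of \<open>X\<close>. The sets \<open>S n\<close> of those elements of
  \<open>X\<close> that project to \<open>c\<close> on \<open>[-n, n]\<close> are affine, decreasing and nonempty. Linear compactness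
  provides a signal that agrees on every finite set of times with elements of every \<open>S n\<close>; it
  belongs to \<open>X\<close> as \<open>X\<close> is closed, and projects to \<open>c\<close>.
\<close>
lemma elimination:
  assumes sig: "X \<subseteq> signals (q + k)" and aff: "affine_behavior X"
    and fd: "finitely_determined (q + k) X"
  shows "finitely_determined k (proj_c k ` X)"
  unfolding finitely_determined_def
proof (intro ballI impI)
  fix c
  assume c: "c \<in> signals k"
    and appr: "\<forall>T. finite T \<longrightarrow> (\<exists>b\<in>proj_c k ` X. \<forall>t\<in>T. b t = c t)"
  define coord :: "signal \<Rightarrow> int \<times> nat \<Rightarrow> real" where
    "coord x = (\<lambda>(t, i). if i < q + k then x t $ i else 0)" for x
  define S where "S n = {x \<in> X. \<forall>t\<in>{- int n..int n}. proj_c k x t = c t}" for n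
  obtain y where y: "\<And>n J. finite J \<Longrightarrow> \<exists>a\<in>coord ` S n. \<forall>p\<in>J. a p = y p"
  proof (rule linear_compactness[of "\<lambda>n. coord ` S n"])
    show "coord ` S n \<noteq> {}" for n
      using appr[rule_format, of "{- int n..int n}"] by (fastforce simp: S_def)
    show "coord ` S n \<subseteq> coord ` S m" if "m \<le> n" for m n
      using that by (fastforce simp: S_def)
    fix n a b r
    assume "a \<in> coord ` S n" "b \<in> coord ` S n"
    then obtain x x' where x: "x \<in> S n" "a = coord x" and x': "x' \<in> S n" "b = coord x'"
      by blast
    have X: "x \<in> X" "x' \<in> X" using x(1) x'(1) by (auto simp: S_def)
    define z where "z = (\<lambda>t. r \<cdot>\<^sub>v x t + (1 - r) \<cdot>\<^sub>v x' t)"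
    have z: "z \<in> X" using aff X unfolding affine_behavior_def z_def by blast
    note dims = signals_dim[OF sig X(1)] signals_dim[OF sig X(2)]
    have "proj_c k z t = c t" if t: "t \<in> {- int n..int n}" for t
    proof (rule eq_vecI)
      show "dim_vec (proj_c k z t) = dim_vec (c t)"
        using signals_dim[OF subset_refl c] by (simp add: proj_c_dim)
    next
      fix i
      assume "i < dim_vec (c t)"
      then have i: "i < k" using signals_dim[OF subset_refl c] by simp
      have "x t $ (q + i) = c t $ i" "x' t $ (q + i) = c t $ i"
        using x(1) x'(1) t i proj_c_nth[OF sig X(1) i, of t] proj_c_nth[OF sig X(2) i, of t]
        by (auto simp: S_def)
      then show "proj_c k z t $ i = c t $ i"
        using proj_c_nth[OF sig z i, of t] dims i by (simp add: z_def algebra_simps)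
    qed
    then have "z \<in> S n" using z by (simp add: S_def)
    moreover have "(\<lambda>p. r * a p + (1 - r) * b p) = coord z"
      using dims by (auto simp: x x' coord_def z_def fun_eq_iff)
    ultimately show "(\<lambda>p. r * a p + (1 - r) * b p) \<in> coord ` S n" by blast
  qed blast
  define x :: signal where "x = (\<lambda>t. vec (q + k) (\<lambda>i. y (t, i)))"
  have approx: "\<exists>z\<in>S n. \<forall>t\<in>T. z t = x t" if T: "finite T" for n T
  proof -
    obtain z where z: "z \<in> S n" "\<forall>p\<in>T \<times> {..<q + k}. coord z p = y p"
      using y[of "T \<times> {..<q + k}" n] T by blast
    have "z t = x t" if "t \<in> T" for t
      using z that signals_dim[OF sig, of z t]
      by (intro eq_vecI) (auto simp: x_def coord_def S_def)
    then show ?thesis using z(1) by blast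
  qed
  have "x \<in> X"
  proof (rule finitely_determinedD[OF fd])
    show "x \<in> signals (q + k)" by (simp add: x_def signals_def)
    show "\<exists>b\<in>X. \<forall>t\<in>T. b t = x t" if "finite T" for T
      using approx[OF that, of 0] by (auto simp: S_def)
  qed
  moreover have "proj_c k x = c"
  proof
    fix t
    obtain z where "z \<in> S (nat \<bar>t\<bar>)" "z t = x t" using approx[of "{t}"] by blast
    moreover have "t \<in> {- int (nat \<bar>t\<bar>)..int (nat \<bar>t\<bar>)}" by auto
    ultimately have "proj_c k z t = c t" unfolding S_def by blast
    moreover have "proj_c k x t = proj_c k z t" using \<open>z t = x t\<close> by (simp add: proj_c_def)
    ultimately show "proj_c k x t = c t" by simp
  qed
  ultimately show "c \<in> proj_c k ` X" by blast
qed

section \<open>Control behaviors and hidden behaviors\<close>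

lemma proj_w_add_diff:
  assumes "B \<subseteq> signals (q + k)" "x \<in> B" "y \<in> B" "z \<in> B"
  shows "proj_w q (\<lambda>t. x t + (y t - z t)) = (\<lambda>t. proj_w q x t + (proj_w q y t - proj_w q z t))"
  using signals_dim[OF assms(1)] assms(2-4)
  by (intro ext eq_vecI) (auto simp: proj_w_def vec_first_def)

lemma proj_w_diff:
  assumes "B \<subseteq> signals (q + k)" "y \<in> B" "z \<in> B"
  shows "proj_w q (\<lambda>t. y t - z t) = (\<lambda>t. proj_w q y t - proj_w q z t)"
  using signals_dim[OF assms(1)] assms(2-3)
  by (intro ext eq_vecI) (auto simp: proj_w_def vec_first_def)

lemma proj_c_diff:
  assumes "B \<subseteq> signals (q + k)" "y \<in> B" "z \<in> B"
  shows "proj_c k (\<lambda>t. y t - z t) = (\<lambda>t. proj_c k y t - proj_c k z t)"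
  using signals_dim[OF assms(1)] assms(2-3)
  by (intro ext eq_vecI) (auto simp: proj_c_def vec_last_def vec_first_def)

lemma proj_c_diff_eq_zero_iff:
  assumes "B \<subseteq> signals (q + k)" "y \<in> B" "z \<in> B"
  shows "proj_c k (\<lambda>t. y t - z t) = zero_signal k \<longleftrightarrow> proj_c k y = proj_c k z"
  unfolding proj_c_diff[OF assms]
  by (auto simp: zero_signal_def fun_eq_iff vec_eq_iff proj_c_dim)

lemma proj_affine:
  assumes "B \<subseteq> signals (q + k)" "x \<in> B" "y \<in> B"
  shows "proj_w q (\<lambda>t. r \<cdot>\<^sub>v x t + (1 - r) \<cdot>\<^sub>v y t) =
      (\<lambda>t. r \<cdot>\<^sub>v proj_w q x t + (1 - r) \<cdot>\<^sub>v proj_w q y t)"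
    and "proj_c k (\<lambda>t. r \<cdot>\<^sub>v x t + (1 - r) \<cdot>\<^sub>v y t) =
      (\<lambda>t. r \<cdot>\<^sub>v proj_c k x t + (1 - r) \<cdot>\<^sub>v proj_c k y t)"
  using signals_dim[OF assms(1)] assms(2-3)
  by (intro ext eq_vecI; auto simp: proj_w_def proj_c_def vec_last_def vec_first_def)+

lemma affine_behaviorsD:
  assumes "B \<in> affine_behaviors q"
  shows "B \<noteq> {}" "B \<subseteq> signals q" "time_invariant B" "affine_behavior B" "finitely_determined q B"
  using assms complete_imp_finitely_determined
  by (auto simp: affine_behaviors_def behavior_def)

text \<open>
  The preimage of \<open>R\<close> in \<open>B\<close> inherits closedness from \<open>B\<close> and \<open>R\<close>; elimination preserves it
  under \<open>proj_c\<close>, and in the presence of affinity and time invariance it is as good as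
  completeness.
\<close>
lemma control_in_affine_behaviors:
  assumes B: "B \<in> affine_behaviors (q + k)" and R: "R \<in> affine_behaviors (ref_dim q k)"
    and ne: "\<exists>x\<in>B. proj_w q x \<in> R"
  shows "proj_c k ` {x \<in> B. proj_w q x \<in> R} \<in> affine_behaviors k"
proof -
  note B = affine_behaviorsD[OF B] and R = affine_behaviorsD[OF R]
  define X where "X = {x \<in> B. proj_w q x \<in> R}"
  have sig: "X \<subseteq> signals (q + k)" using B(2) by (auto simp: X_def)
  have aff: "affine_behavior X"
    using B(4) R(4) proj_affine(1)[OF B(2)]
    by (simp add: affine_behavior_def X_def)
  have ti: "time_invariant X"
  proof -
    have "proj_w q (shift \<tau> x) = shift \<tau> (proj_w q x)" for \<tau> x
      by (simp add: proj_w_def shift_def)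
    then show ?thesis using B(3) R(3) by (simp add: time_invariant_def X_def)
  qed
  have fd: "finitely_determined (q + k) X"
    unfolding finitely_determined_def
  proof (intro ballI impI)
    fix x
    assume x: "x \<in> signals (q + k)"
      and appr: "\<forall>T. finite T \<longrightarrow> (\<exists>b\<in>X. \<forall>t\<in>T. b t = x t)"
    have "x \<in> B"
      by (rule finitely_determinedD[OF B(5) x]) (use appr in \<open>auto simp: X_def\<close>)
    moreover have "proj_w q x \<in> R"
    proof (rule finitely_determinedD[OF R(5)])
      show "proj_w q x \<in> signals (ref_dim q k)"
        using proj_w_dim[OF B(2) \<open>x \<in> B\<close>] by (auto simp: signals_def intro: carrier_vecI)
      fix T :: "int set"
      assume "finite T"
      then obtain b where "b \<in> X" "\<forall>t\<in>T. b t = x t" using appr by blast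
      then show "\<exists>b\<in>R. \<forall>t\<in>T. b t = proj_w q x t"
        by (intro bexI[of _ "proj_w q b"]) (auto simp: proj_w_def X_def)
    qed
    ultimately show "x \<in> X" by (simp add: X_def)
  qed
  have Csig: "proj_c k ` X \<subseteq> signals k"
    using proj_c_dim by (auto simp: signals_def intro: carrier_vecI)
  have Caff: "affine_behavior (proj_c k ` X)"
    unfolding affine_behavior_def ball_simps
  proof (intro ballI allI)
    fix x y r
    assume "x \<in> X" "y \<in> X"
    then show "(\<lambda>t. r \<cdot>\<^sub>v proj_c k x t + (1 - r) \<cdot>\<^sub>v proj_c k y t) \<in> proj_c k ` X"
      using proj_affine(2)[OF sig, symmetric] aff by (auto simp: affine_behavior_def)
  qed
  have "shift \<tau> (proj_c k x) = proj_c k (shift \<tau> x)" for \<tau> x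
    by (simp add: proj_c_def shift_def)
  then have Cti: "time_invariant (proj_c k ` X)"
    using ti by (auto simp: time_invariant_def)
  have "complete_behavior k (proj_c k ` X)"
    by (rule finitely_determined_imp_complete[OF Csig Caff Cti elimination[OF sig aff fd]])
  then show ?thesis
    using ne Csig Caff Cti unfolding affine_behaviors_def behavior_def X_def by auto
qed

text \<open>
  The set obtained by fixing the control of \<open>x\<close> depends on \<open>x\<close> only through its first component.
  For \<open>q = 0\<close> the hidden behavior is zero and both sides are \<open>{x}\<close>.
\<close>
lemma translate_hidden_eq:
  assumes sig: "B \<subseteq> signals (q + k)" and aff: "affine_behavior B" and x: "x \<in> B"
  shows "translate (proj_w q x) (controlled q k (dif B) {zero_signal k}) =
    controlled q k B {proj_c k x}"
proof -
  have eq: "x t + (y t - x t) = y t" if "y \<in> B" for y t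
    using signals_dim[OF sig x] signals_dim[OF sig that] by (intro eq_vecI) auto
  show ?thesis
  proof (intro equalityI subsetI)
    fix w
    assume "w \<in> translate (proj_w q x) (controlled q k (dif B) {zero_signal k})"
    then obtain y z where yz: "y \<in> B" "z \<in> B" "proj_c k y = proj_c k z"
      and w: "w = (\<lambda>t. proj_w q x t + proj_w q (\<lambda>t. y t - z t) t)"
      using proj_c_diff_eq_zero_iff[OF sig]
      by (auto simp: translate_def controlled_def join_def dif_def)
    define v where "v = (\<lambda>t. x t + (y t - z t))"
    have v: "v \<in> B" unfolding v_def by (rule affine_add_diff[OF aff sig x yz(1,2)])
    have "w = proj_w q v"
      unfolding w v_def proj_w_add_diff[OF sig x yz(1,2)] proj_w_diff[OF sig yz(1,2)] ..
    moreover have "proj_c k v = proj_c k x"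
    proof -
      have "(\<lambda>t. v t - x t) = (\<lambda>t. y t - z t)"
        using signals_dim[OF sig] x yz by (intro ext eq_vecI) (auto simp: v_def)
      then show ?thesis
        using proj_c_diff_eq_zero_iff[OF sig v x] proj_c_diff_eq_zero_iff[OF sig yz(1,2)] yz(3)
        by simp
    qed
    ultimately show "w \<in> controlled q k B {proj_c k x}"
      using v by (auto simp: controlled_def join_def)
  next
    fix w
    assume "w \<in> controlled q k B {proj_c k x}"
    then obtain y where y: "y \<in> B" "proj_c k y = proj_c k x" "w = proj_w q y"
      by (auto simp: controlled_def join_def)
    have "w = (\<lambda>t. proj_w q x t + proj_w q (\<lambda>t. y t - x t) t)"
      unfolding proj_w_diff[OF sig y(1) x] y(3) proj_w_add_diff[OF sig x y(1) x, symmetric]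
      by (simp add: eq[OF y(1)])
    moreover have "(\<lambda>t. y t - x t) \<in> dif B" using y(1) x by (auto simp: dif_def)
    ultimately show "w \<in> translate (proj_w q x) (controlled q k (dif B) {zero_signal k})"
      using proj_c_diff_eq_zero_iff[OF sig y(1) x] y(2)
      by (auto simp: translate_def controlled_def join_def)
  qed
qed

section \<open>Implementability\<close>

theorem mainTheorem4:
  fixes q k :: nat and B R :: "signal set" and w0 :: signal
  assumes "B \<in> affine_behaviors (q + k)"
    and "R \<in> affine_behaviors (ref_dim q k)"
    and "w0 \<in> R"
  shows "(implementable q k B R \<longleftrightarrow>
            R \<subseteq> proj_w q ` B \<and>
            (\<exists>c0\<in>signals k. pair_mem q w0 c0 B \<and> controlled q k B {c0} \<subseteq> R))
       \<and> (implementable q k B R \<longleftrightarrow>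
            translate w0 (controlled q k (dif B) {zero_signal k}) \<subseteq> R \<and> R \<subseteq> proj_w q ` B)"
proof -
  note B = affine_behaviorsD[OF assms(1)] and R = affine_behaviorsD[OF assms(2)]
  let ?hidden = "controlled q k (dif B) {zero_signal k}"
  have i_iii: "translate w0 ?hidden \<subseteq> R \<and> R \<subseteq> proj_w q ` B" if impl: "implementable q k B R"
  proof -
    obtain C where C: "controlled q k B C = R" using impl unfolding implementable_def by blast
    then obtain x where x: "x \<in> B" "proj_c k x \<in> C" "w0 = proj_w q x"
      using assms(3) by (auto simp: controlled_def join_def)
    have "translate w0 ?hidden = controlled q k B {proj_c k x}"
      using translate_hidden_eq[OF B(2,4) x(1)] x(3) by simp
    then show ?thesis using C x(2) by (auto simp: controlled_def join_def)
  qed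
  have iii_i: "implementable q k B R" if "translate w0 ?hidden \<subseteq> R" "R \<subseteq> proj_w q ` B"
  proof -
    define C where "C = proj_c k ` {x \<in> B. proj_w q x \<in> R}"
    have "C \<in> affine_behaviors k"
      unfolding C_def
      by (rule control_in_affine_behaviors[OF assms(1,2)]) (use that(2) assms(3) in blast)
    moreover have "controlled q k B C = R"
    proof
      show "R \<subseteq> controlled q k B C"
        using that(2) by (auto simp: controlled_def join_def C_def)
      show "controlled q k B C \<subseteq> R"
      proof
        fix w
        assume "w \<in> controlled q k B C"
        then obtain y z where y: "y \<in> B" "w = proj_w q y"
          and z: "z \<in> B" "proj_w q z \<in> R" "proj_c k y = proj_c k z"
          by (auto simp: controlled_def join_def C_def)
        \<comment> \<open>Move the hidden difference from the base point \<open>w0\<close> to the point \<open>proj_w q z\<close> of \<open>R\<close>.\<close>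
        have "(\<lambda>t. y t - z t) \<in> dif B" using y(1) z(1) by (auto simp: dif_def)
        then have "proj_w q (\<lambda>t. y t - z t) \<in> ?hidden"
          using proj_c_diff_eq_zero_iff[OF B(2) y(1) z(1)] z(3)
          by (auto simp: controlled_def join_def)
        then have "(\<lambda>t. w0 t + proj_w q (\<lambda>t. y t - z t) t) \<in> R"
          using that(1) by (auto simp: translate_def)
        from affine_add_diff[OF R(4,2) z(2) this assms(3)]
        have "(\<lambda>t. proj_w q z t + (w0 t + proj_w q (\<lambda>t. y t - z t) t - w0 t)) \<in> R" .
        moreover have "(\<lambda>t. proj_w q z t + (w0 t + proj_w q (\<lambda>t. y t - z t) t - w0 t)) = w"
          unfolding proj_w_diff[OF B(2) y(1) z(1)] y(2)
          using signals_dim[OF R(2) assms(3)] proj_w_dim[OF B(2) y(1)] proj_w_dim[OF B(2) z(1)]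
          by (intro ext eq_vecI) auto
        ultimately show "w \<in> R" by simp
      qed
    qed
    ultimately show ?thesis by (auto simp: implementable_def)
  qed
  have ii_iii: "(\<exists>c0\<in>signals k. pair_mem q w0 c0 B \<and> controlled q k B {c0} \<subseteq> R) \<longleftrightarrow>
      translate w0 ?hidden \<subseteq> R" if sub: "R \<subseteq> proj_w q ` B"
  proof -
    have w0: "w0 \<in> signals (ref_dim q k)" using R(2) assms(3) by blast
    have pm: "pair_mem q w0 c0 B \<longleftrightarrow> (\<exists>x\<in>B. proj_w q x = w0 \<and> proj_c k x = c0)"
      if "c0 \<in> signals k" for c0
      by (rule pair_mem_iff_proj[OF B(2) w0 that])
    have "proj_c k x \<in> signals k" for x
      using proj_c_dim by (auto simp: signals_def intro: carrier_vecI)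
    then have "(\<exists>c0\<in>signals k. pair_mem q w0 c0 B \<and> controlled q k B {c0} \<subseteq> R) \<longleftrightarrow>
        (\<exists>x\<in>B. proj_w q x = w0 \<and> controlled q k B {proj_c k x} \<subseteq> R)"
      using pm by blast
    also have "\<dots> \<longleftrightarrow> (\<exists>x\<in>B. proj_w q x = w0 \<and> translate w0 ?hidden \<subseteq> R)"
      using translate_hidden_eq[OF B(2,4)] by blast
    also have "\<dots> \<longleftrightarrow> translate w0 ?hidden \<subseteq> R"
      using sub assms(3) by blast
    finally show ?thesis .
  qed
  show ?thesis using i_iii iii_i ii_iii by blast
qed

end
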